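(* Let $X$ be a real Hilbert space, let $f\colon X\to\mathbb{R}$ be convex and continuous with $C=\{x\in X : f(x)\le 0\}\neq\varnothing$, let $s\colon X\to X$ be a selection of $\partial f$, and let $G\colon X\to X$ be the associated subgradient projector. Let $\bar{x}\in X\setminus C$. Then the following are equivalent: (i) $f$ is Fréchet differentiable at $\bar{x}$. (ii) $G$ is (strong-to-strong) continuous at $\bar{x}$. (iii) $f$ is Gâteaux differentiable at $\bar{x}$ and $G$ is strong-to-weak continuous at $\bar{x}$.
   Context: $\partial f$ is the convex subdifferential; a selection of $\partial f$ is a map $s\colon X\to X$ with $s(x)\in\partial f(x)$ for all $x\in X$. The subgradient projector associated with $f$ and $s$ is $G\colon X\to X$, $Gx = x-\frac{f(x)}{\|s(x)\|^2}s(x)$ if $f(x)>0$, and $Gx=x$ otherwise (well defined, since $C\ne\varnothing$ implies $0\notin\partial f(x)$ whenever $f(x)>0$). $G$ is strong-to-weak continuous at $\bar x$ if $x_n\to\bar x$ in norm implies $Gx_n\rightharpoonup G\bar x$ weakly. *)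

theory Defs
  imports "HOL-Analysis.Analysis"
begin

definition subdifferential :: "('a::real_inner \<Rightarrow> real) \<Rightarrow> 'a \<Rightarrow> 'a set" where
  "subdifferential f x = {u. \<forall>y. f x + u \<bullet> (y - x) \<le> f y}"

definition subdifferential_selection :: "('a::real_inner \<Rightarrow> real) \<Rightarrow> ('a \<Rightarrow> 'a) \<Rightarrow> bool" where
  "subdifferential_selection f s \<longleftrightarrow> (\<forall>x. s x \<in> subdifferential f x)"

definition subgradient_projector :: "('a::real_inner \<Rightarrow> real) \<Rightarrow> ('a \<Rightarrow> 'a) \<Rightarrow> 'a \<Rightarrow> 'a" where
  "subgradient_projector f s x = (if f x > 0 then x - (f x / (norm (s x))\<^sup>2) *\<^sub>R s x else x)"

text \<open>The division by the squared norm of \<open>s x\<close> never divides by zero when the zero sublevel set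
  is nonempty:\<close>

lemma subdifferential_nonzero:
  assumes "f z \<le> 0" and "f x > 0"
  shows "0 \<notin> subdifferential f x"
  using assms by (auto simp: subdifferential_def not_le intro!: exI[of _ z])

text \<open>The derivative is required to be linear and bounded, so this is stronger than the existence of
  all directional derivatives.\<close>

definition gateaux_differentiable_at ::
    "('a::real_normed_vector \<Rightarrow> 'b::real_normed_vector) \<Rightarrow> 'a \<Rightarrow> bool" where
  "gateaux_differentiable_at f x \<longleftrightarrow>
     (\<exists>D. bounded_linear D \<and>
        (\<forall>h. ((\<lambda>t::real. (f (x + t *\<^sub>R h) - f x) /\<^sub>R t) \<longlongrightarrow> D h) (at 0)))"

text \<open>Weak convergence is tested against inner products only; in a Hilbert space these are all the
  continuous linear functionals, by Riesz representation.\<close>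

definition weakly_tendsto :: "(nat \<Rightarrow> 'a::real_inner) \<Rightarrow> 'a \<Rightarrow> bool" where
  "weakly_tendsto X l \<longleftrightarrow> (\<forall>u. (\<lambda>n. X n \<bullet> u) \<longlonglongrightarrow> l \<bullet> u)"

definition strong_to_weak_continuous_at :: "('a::real_inner \<Rightarrow> 'b::real_inner) \<Rightarrow> 'a \<Rightarrow> bool" where
  "strong_to_weak_continuous_at G x \<longleftrightarrow>
     (\<forall>X. X \<longlonglongrightarrow> x \<longrightarrow> weakly_tendsto (\<lambda>n. G (X n)) (G x))"

end

theory Submission
  imports Defs
begin

text \<open>Where \<open>f > 0\<close>, the displacement \<open>x - G x\<close> is the inverse of \<open>s x\<close> in the sphere of
  radius \<open>sqrt (f x)\<close>, and vice versa. Hence \<open>G\<close> is continuous at \<open>xbar\<close> iff \<open>s\<close> is, and the latter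
  is equivalent to Frechet differentiability of \<open>f\<close>. Gateaux differentiability makes
  \<open>\<lambda>y. s y \<bullet> h\<close> continuous at \<open>xbar\<close> for every \<open>h\<close>; testing the weak convergence of \<open>G\<close> against
  \<open>s xbar\<close> then gives convergence of the norms \<open>norm (s y)\<close>, which upgrades weak to strong
  continuity of \<open>s\<close>.\<close>

section \<open>Subgradients and Frechet differentiability\<close>

lemma subdifferentialD: "u \<in> subdifferential f x \<Longrightarrow> f x + u \<bullet> (y - x) \<le> f y"
  by (simp add: subdifferential_def)

text \<open>A subgradient \<open>u\<close> at \<open>x\<close> makes \<open>x\<close> a global
  minimizer of \<open>f\<close> minus the linear functional of \<open>u\<close>, so the derivative
  of that difference vanishes at \<open>x\<close>.\<close>

lemma has_derivative_subgradient_unique: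
  fixes f :: "'a::real_inner \<Rightarrow> real"
  assumes D: "(f has_derivative D) (at x)" and u: "u \<in> subdifferential f x"
  shows "D = (\<lambda>h. u \<bullet> h)"
proof -
  have "((\<lambda>y. f y - u \<bullet> y) has_derivative (\<lambda>h. D h - u \<bullet> h)) (at x)"
    by (rule has_derivative_diff[OF D bounded_linear_imp_has_derivative[OF bounded_linear_inner_right]])
  moreover have "\<forall>y. f x - u \<bullet> x \<le> f y - u \<bullet> y"
    using subdifferentialD[OF u] by (simp add: inner_diff_right algebra_simps)
  ultimately have "(\<lambda>h. D h - u \<bullet> h) = (\<lambda>h. 0)"
    by (intro has_derivative_local_min) auto
  then show ?thesis
    by (simp add: fun_eq_iff)
qed

text \<open>The first-order estimate at \<open>x\<close> is uniform over directions, so it may be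
  tested at a point \<open>z\<close> that depends on \<open>y\<close>. If \<open>s y\<close> were
  far from \<open>s x\<close>, the affine minorant at \<open>y\<close> would exceed that estimate at
  \<open>z\<close>.\<close>

lemma differentiable_imp_isCont_subgradient:
  fixes f :: "'a::real_inner \<Rightarrow> real"
  assumes diff: "f differentiable (at x)" and sel: "subdifferential_selection f s"
  shows "isCont s x"
  unfolding continuous_at_eps_delta
proof (intro allI impI)
  fix e :: real assume e: "e > 0"
  have s: "s y \<in> subdifferential f y" for y
    using sel by (simp add: subdifferential_selection_def)
  obtain D where "(f has_derivative D) (at x)"
    using diff by (auto simp: differentiable_def)
  with has_derivative_subgradient_unique[OF this s]
  have "(f has_derivative (\<lambda>h. s x \<bullet> h)) (at x)"
    by simp
  then obtain d where d: "d > 0" and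
    near: "\<And>z. norm (z - x) < d \<Longrightarrow>
      norm (f z - f x - s x \<bullet> (z - x)) \<le> e / 3 * norm (z - x)"
    using e unfolding has_derivative_at_alt by (metis zero_less_divide_iff zero_less_numeral)
  \<comment> \<open>The radius \<open>d / 3\<close> leaves room for a further step of length
    \<open>d / 3\<close> inside the ball of radius \<open>d\<close>; with tolerance
    \<open>e / 3\<close> the final bound is \<open>2 * e / 3\<close>.\<close>
  have "dist (s y) (s x) < e" if y: "dist y x < d / 3" for y
  proof (cases "s y = s x")
    case False
    define u where "u = s y - s x"
    have u: "norm u > 0"
      using False by (simp add: u_def)
    \<comment> \<open>Compare the supporting hyperplanes at \<open>x\<close> and \<open>y\<close> in the direction in which they differ most.\<close>
    define z where "z = y + (d / (3 * norm u)) *\<^sub>R u"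
    have "norm (z - x) \<le> norm (y - x) + norm ((d / (3 * norm u)) *\<^sub>R u)"
      using norm_triangle_ineq[of "y - x" "(d / (3 * norm u)) *\<^sub>R u"]
      by (simp add: z_def algebra_simps)
    also have "\<dots> < 2 * d / 3"
      using y d u by (simp add: dist_norm)
    finally have zx: "norm (z - x) < 2 * d / 3" .
    have "f z - f x - s x \<bullet> (z - x) \<le> e / 3 * norm (z - x)"
      by (rule order_trans[OF abs_ge_self near[unfolded real_norm_def]]) (use zx d in simp)
    also have "\<dots> < e / 3 * (2 * d / 3)"
      using zx e by (intro mult_strict_left_mono) auto
    \<comment> \<open>Adding the subgradient inequalities from \<open>y\<close> to \<open>z\<close>
      and from \<open>x\<close> to \<open>y\<close> bounds the remainder at \<open>z\<close> below
      by \<open>u \<bullet> (z - y)\<close>.\<close>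
    finally have "u \<bullet> (z - y) < e / 3 * (2 * d / 3)"
      using subdifferentialD[OF s, of y z] subdifferentialD[OF s, of x y]
      by (simp add: u_def inner_diff_left inner_diff_right)
    moreover have "u \<bullet> (z - y) = d / 3 * norm u"
      using u by (simp add: z_def dot_square_norm power2_eq_square)
    ultimately have "d * norm u < d * (2 * e / 3)"
      by (simp add: algebra_simps)
    then have "norm u < 2 * e / 3"
      using d by simp
    then show ?thesis
      using e by (simp add: u_def dist_norm)
  qed (use e in simp)
  then show "\<exists>d>0. \<forall>y. dist y x < d \<longrightarrow> dist (s y) (s x) < e"
    using d by (intro exI[of _ "d / 3"]) auto
qed

text \<open>The first-order remainder is nonnegative by the subgradient inequality at
  \<open>x\<close>, and at most \<open>(s y - s x) \<bullet> (y - x)\<close> by the one at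
  \<open>y\<close>.\<close>

lemma isCont_subgradient_imp_has_derivative:
  fixes f :: "'a::real_inner \<Rightarrow> real"
  assumes cont: "isCont s x" and sel: "subdifferential_selection f s"
  shows "(f has_derivative (\<lambda>h. s x \<bullet> h)) (at x)"
  unfolding has_derivative_at_alt
proof (intro conjI allI impI)
  show "bounded_linear (\<lambda>h. s x \<bullet> h)"
    by (rule bounded_linear_inner_right)
  have s: "s y \<in> subdifferential f y" for y
    using sel by (simp add: subdifferential_selection_def)
  fix e :: real assume "e > 0"
  then obtain d where d: "d > 0" and near: "\<And>y. dist y x < d \<Longrightarrow> dist (s y) (s x) < e"
    using cont unfolding continuous_at_eps_delta by blast
  have "norm (f y - f x - s x \<bullet> (y - x)) \<le> e * norm (y - x)" if "norm (y - x) < d" for y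
  proof -
    have "f y - f x - s x \<bullet> (y - x) \<le> (s y - s x) \<bullet> (y - x)"
      using subdifferentialD[OF s, of y x] by (simp add: inner_diff_left inner_diff_right)
    also have "\<dots> \<le> norm (s y - s x) * norm (y - x)"
      by (rule norm_cauchy_schwarz)
    also have "\<dots> \<le> e * norm (y - x)"
      using near[of y] that by (intro mult_right_mono) (auto simp: dist_norm)
    finally show ?thesis
      using subdifferentialD[OF s, of x y] by simp
  qed
  then show "\<exists>d>0. \<forall>y. norm (y - x) < d \<longrightarrow>
      norm (f y - f x - s x \<bullet> (y - x)) \<le> e * norm (y - x)"
    using d by blast
qed

lemma differentiable_iff_isCont_subgradient:
  fixes f :: "'a::real_inner \<Rightarrow> real"
  assumes "subdifferential_selection f s"
  shows "f differentiable (at x) \<longleftrightarrow> isCont s x"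
  using differentiable_imp_isCont_subgradient isCont_subgradient_imp_has_derivative assms
  by (metis differentiable_def)

section \<open>Gateaux differentiability\<close>

lemma differentiable_imp_gateaux_differentiable_at:
  assumes "f differentiable (at x)"
  shows "gateaux_differentiable_at f x"
proof -
  obtain D where D: "(f has_derivative D) (at x)"
    using assms by (auto simp: differentiable_def)
  then interpret D: bounded_linear D
    by (rule has_derivative_bounded_linear)
  have "((\<lambda>t::real. (f (x + t *\<^sub>R h) - f x) /\<^sub>R t) \<longlongrightarrow> D h) (at 0)" for h
  proof -
    have "((\<lambda>t. f (x + t *\<^sub>R h)) has_derivative (\<lambda>t. D (t *\<^sub>R h))) (at 0)"
      by (rule has_derivative_compose[where g = f])
        (use D in \<open>auto intro!: derivative_eq_intros\<close>)
    then have "((\<lambda>t. norm (f (x + t *\<^sub>R h) - f x - D (t *\<^sub>R h)) / norm t) \<longlongrightarrow> 0) (at 0)"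
      by (simp add: has_derivative_iff_norm)
    moreover have "\<forall>\<^sub>F t in at 0. norm (f (x + t *\<^sub>R h) - f x - D (t *\<^sub>R h)) / norm t =
        norm ((f (x + t *\<^sub>R h) - f x) /\<^sub>R t - D h)"
    proof (rule eventually_at_filter[THEN iffD2], intro always_eventually allI impI)
      fix t :: real assume "t \<noteq> 0"
      then have "(f (x + t *\<^sub>R h) - f x) /\<^sub>R t - D h = (f (x + t *\<^sub>R h) - f x - D (t *\<^sub>R h)) /\<^sub>R t"
        by (simp add: D.scaleR scaleR_diff_right)
      then show "norm (f (x + t *\<^sub>R h) - f x - D (t *\<^sub>R h)) / norm t =
          norm ((f (x + t *\<^sub>R h) - f x) /\<^sub>R t - D h)"
        by (simp add: divide_inverse_commute)
    qed
    ultimately have "((\<lambda>t. norm ((f (x + t *\<^sub>R h) - f x) /\<^sub>R t - D h)) \<longlongrightarrow> 0) (at 0)"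
      by (rule Lim_transform_eventually)
    then show ?thesis
      by (simp only: tendsto_norm_zero_iff LIM_zero_iff)
  qed
  then show ?thesis
    unfolding gateaux_differentiable_at_def using D.bounded_linear_axioms by blast
qed

text \<open>Difference quotients of \<open>f\<close> at \<open>y\<close> bound
  \<open>s y \<bullet> h\<close> from above for \<open>t > 0\<close> and from below for
  \<open>t < 0\<close>. First \<open>t\<close> is fixed so that the quotient at \<open>x\<close> is
  close to \<open>D\<close>, then \<open>y\<close> tends to \<open>x\<close>.\<close>

lemma gateaux_differentiable_at_imp_isCont_inner_subgradient:
  fixes f :: "'a::real_inner \<Rightarrow> real"
  assumes gat: "gateaux_differentiable_at f x" and cont: "continuous_on UNIV f"
    and sel: "subdifferential_selection f s"
  shows "isCont (\<lambda>y. s y \<bullet> h) x"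
proof -
  have sub: "s y \<bullet> (t *\<^sub>R h) \<le> f (y + t *\<^sub>R h) - f y" for y t
    using sel subdifferentialD[of "s y" f y "y + t *\<^sub>R h"]
    by (simp add: subdifferential_selection_def)
  obtain D where D: "((\<lambda>t. (f (x + t *\<^sub>R h) - f x) / t) \<longlongrightarrow> D) (at 0)"
    using gat unfolding gateaux_differentiable_at_def by (auto simp: divide_inverse_commute)
  have q: "((\<lambda>y. (f (y + t *\<^sub>R h) - f y) / t) \<longlongrightarrow> (f (x + t *\<^sub>R h) - f x) / t) (nhds x)" for t
  proof -
    have "continuous_on UNIV (\<lambda>y. (f (y + t *\<^sub>R h) - f y) * inverse t)"
      by (intro continuous_intros continuous_on_compose2[OF cont]) auto
    then have "((\<lambda>y. (f (y + t *\<^sub>R h) - f y) * inverse t)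
        \<longlongrightarrow> (f (x + t *\<^sub>R h) - f x) * inverse t) (at x)"
      by (simp add: continuous_on_def)
    then show ?thesis
      unfolding divide_inverse by (subst (asm) tendsto_at_iff_tendsto_nhds)
  qed
  \<comment> \<open>Since \<open>nhds x\<close> sees the point \<open>x\<close> itself, this limit
    also forces \<open>D = s x \<bullet> h\<close>, which turns convergence into continuity.\<close>
  have "((\<lambda>y. s y \<bullet> h) \<longlongrightarrow> D) (nhds x)"
  proof (rule order_tendstoI)
    fix a assume "D < a"
    then have "\<forall>\<^sub>F t in at_right 0. (f (x + t *\<^sub>R h) - f x) / t < a"
      using order_tendstoD(2)[OF D] by (auto simp: eventually_at_split)
    moreover have "\<forall>\<^sub>F t in at_right (0::real). t > 0"
      by (rule eventually_at_right_less)
    ultimately have "\<forall>\<^sub>F t in at_right 0. t > 0 \<and> (f (x + t *\<^sub>R h) - f x) / t < a"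
      by eventually_elim simp
    then obtain t where t: "t > 0" "(f (x + t *\<^sub>R h) - f x) / t < a"
      using eventually_happens' trivial_limit_at_right_real by blast
    have "s y \<bullet> h \<le> (f (y + t *\<^sub>R h) - f y) / t" for y
      using sub[of y t] t(1) by (simp add: field_simps)
    then show "\<forall>\<^sub>F y in nhds x. s y \<bullet> h < a"
      using order_tendstoD(2)[OF q t(2)] by (auto elim!: eventually_mono intro: le_less_trans)
  next
    fix a assume "a < D"
    then have "\<forall>\<^sub>F t in at_left 0. a < (f (x + t *\<^sub>R h) - f x) / t"
      using order_tendstoD(1)[OF D] by (auto simp: eventually_at_split)
    moreover have "\<forall>\<^sub>F t in at_left (0::real). t < 0"
      by (simp add: eventually_at_filter)
    ultimately have "\<forall>\<^sub>F t in at_left 0. t < 0 \<and> a < (f (x + t *\<^sub>R h) - f x) / t"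
      by eventually_elim simp
    then obtain t where t: "t < 0" "a < (f (x + t *\<^sub>R h) - f x) / t"
      using eventually_happens' trivial_limit_at_left_real by blast
    have "(f (y + t *\<^sub>R h) - f y) / t \<le> s y \<bullet> h" for y
      using sub[of y t] t(1) by (simp add: field_simps)
    then show "\<forall>\<^sub>F y in nhds x. a < s y \<bullet> h"
      using order_tendstoD(1)[OF q t(2)] by (auto elim!: eventually_mono intro: less_le_trans)
  qed
  then show ?thesis
    by (simp add: isCont_def tendsto_nhds_iff)
qed

section \<open>Continuity of the projector\<close>

text \<open>Near \<open>x\<close> the value \<open>f y\<close> stays positive, so \<open>s y\<close>
  and \<open>y - G y\<close> determine each other by the same formula, which is continuous away from
  zero.\<close>

lemma isCont_subgradient_projector_iff:
  fixes f :: "'a::real_inner \<Rightarrow> real"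
  assumes f: "isCont f x" "f x > 0" and s: "s x \<noteq> 0" "\<And>y. f y > 0 \<Longrightarrow> s y \<noteq> 0"
  shows "isCont (subgradient_projector f s) x \<longleftrightarrow> isCont s x"
proof -
  have "(f \<longlongrightarrow> f x) (nhds x)"
    using f by (simp add: isCont_def tendsto_at_iff_tendsto_nhds)
  then have pos: "\<forall>\<^sub>F y in nhds x. f y > 0"
    using f(2) by (rule order_tendstoD)
  let ?G = "subgradient_projector f s"
  show ?thesis
  proof
    assume G: "isCont ?G x"
    have inv: "s y = (f y / (norm (y - ?G y))\<^sup>2) *\<^sub>R (y - ?G y)" if "f y > 0" for y
      using that s(2)[OF that] by (simp add: subgradient_projector_def power2_eq_square)
    \<comment> \<open>A zero displacement would make \<open>s x\<close> zero through
      \<open>inv\<close>.\<close>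
    then have "x - ?G x \<noteq> 0"
      using f(2) s(1) by (metis scaleR_zero_right)
    then have "isCont (\<lambda>y. (f y / (norm (y - ?G y))\<^sup>2) *\<^sub>R (y - ?G y)) x"
      by (intro continuous_intros f G) auto
    moreover have "\<forall>\<^sub>F y in nhds x. s y = (f y / (norm (y - ?G y))\<^sup>2) *\<^sub>R (y - ?G y)"
      using pos by eventually_elim (rule inv)
    ultimately show "isCont s x"
      by (simp add: isCont_cong)
  next
    assume "isCont s x"
    then have "isCont (\<lambda>y. y - (f y / (norm (s y))\<^sup>2) *\<^sub>R s y) x"
      using s(1) by (intro continuous_intros f) auto
    moreover have "\<forall>\<^sub>F y in nhds x. ?G y = y - (f y / (norm (s y))\<^sup>2) *\<^sub>R s y"
      using pos by eventually_elim (simp add: subgradient_projector_def)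
    ultimately show "isCont ?G x"
      by (simp add: isCont_cong)
  qed
qed

section \<open>From weak to strong continuity\<close>

text \<open>Expanding the squared norm of \<open>g n - l\<close> leaves only the two given limits,
  and they cancel against the squared norm of \<open>l\<close>.\<close>

lemma tendsto_of_inner_of_norm:
  fixes l :: "'a::real_inner"
  assumes "((\<lambda>n. g n \<bullet> l) \<longlongrightarrow> (norm l)\<^sup>2) F" and "((\<lambda>n. (norm (g n))\<^sup>2) \<longlongrightarrow> (norm l)\<^sup>2) F"
  shows "(g \<longlongrightarrow> l) F"
proof -
  have "((\<lambda>n. sqrt ((norm (g n))\<^sup>2 - 2 * (g n \<bullet> l) + (norm l)\<^sup>2))
      \<longlongrightarrow> sqrt ((norm l)\<^sup>2 - 2 * (norm l)\<^sup>2 + (norm l)\<^sup>2)) F"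
    by (intro tendsto_intros assms)
  moreover have "norm (g n - l) = sqrt ((norm (g n))\<^sup>2 - 2 * (g n \<bullet> l) + (norm l)\<^sup>2)" for n
    by (simp add: norm_eq_sqrt_inner power2_norm_eq_inner inner_diff inner_commute)
  ultimately have "((\<lambda>n. norm (g n - l)) \<longlongrightarrow> 0) F"
    by simp
  then show ?thesis
    by (simp add: Lim_null[of g] tendsto_norm_zero_iff)
qed

lemma isCont_imp_strong_to_weak_continuous_at:
  "isCont G x \<Longrightarrow> strong_to_weak_continuous_at G x"
  unfolding strong_to_weak_continuous_at_def weakly_tendsto_def
  by (auto intro: tendsto_inner isCont_tendsto_compose[where g = G])

text \<open>Pairing \<open>y - G y\<close> with \<open>s x\<close> gives
  \<open>f y * (s y \<bullet> s x)\<close> divided by the squared norm of \<open>s y\<close>. Every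
  other quantity in this identity converges, so solving for the squared norm gives its
  limit.\<close>

lemma strong_to_weak_continuous_at_imp_isCont_subgradient:
  fixes f :: "'a::real_inner \<Rightarrow> real"
  assumes f: "isCont f x" "f x > 0" and s: "s x \<noteq> 0"
    and inner: "isCont (\<lambda>y. s y \<bullet> s x) x"
    and weak: "strong_to_weak_continuous_at (subgradient_projector f s) x"
  shows "isCont s x"
  unfolding continuous_at_sequentially comp_def
proof (intro allI impI)
  let ?G = "subgradient_projector f s"
  fix X assume X: "X \<longlonglongrightarrow> x"
  have fX: "(\<lambda>n. f (X n)) \<longlonglongrightarrow> f x"
    using f(1) X by (rule isCont_tendsto_compose)
  have sX: "(\<lambda>n. s (X n) \<bullet> s x) \<longlonglongrightarrow> (norm (s x))\<^sup>2"
    using isCont_tendsto_compose[OF inner X] by (simp add: dot_square_norm)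
  have "(\<lambda>n. ?G (X n) \<bullet> s x) \<longlonglongrightarrow> ?G x \<bullet> s x"
    using weak X unfolding strong_to_weak_continuous_at_def weakly_tendsto_def by blast
  then have "(\<lambda>n. X n \<bullet> s x - ?G (X n) \<bullet> s x) \<longlonglongrightarrow> x \<bullet> s x - ?G x \<bullet> s x"
    by (rule tendsto_diff[OF tendsto_inner[OF X tendsto_const]])
  moreover have "x \<bullet> s x - ?G x \<bullet> s x = f x"
    using f(2) s by (simp add: subgradient_projector_def inner_diff_left dot_square_norm)
  ultimately have GX: "(\<lambda>n. X n \<bullet> s x - ?G (X n) \<bullet> s x) \<longlonglongrightarrow> f x"
    by simp
  have "(\<lambda>n. f (X n) * (s (X n) \<bullet> s x) / (X n \<bullet> s x - ?G (X n) \<bullet> s x))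
      \<longlonglongrightarrow> f x * (norm (s x))\<^sup>2 / f x"
    using f(2) by (intro tendsto_intros fX sX GX) auto
  moreover have "\<forall>\<^sub>F n in sequentially.
      f (X n) * (s (X n) \<bullet> s x) / (X n \<bullet> s x - ?G (X n) \<bullet> s x) = (norm (s (X n)))\<^sup>2"
  proof -
    have "\<forall>\<^sub>F n in sequentially. f (X n) > 0"
      using fX f(2) by (rule order_tendstoD)
    \<comment> \<open>Positivity lets this inner product be cancelled in the quotient and also keeps
      \<open>s (X n)\<close> away from the value 0.\<close>
    moreover have "\<forall>\<^sub>F n in sequentially. s (X n) \<bullet> s x > 0"
      using sX s by (intro order_tendstoD(1)) auto
    ultimately show ?thesis
      by eventually_elim (auto simp: subgradient_projector_def inner_diff_left)
  qed
  ultimately have "(\<lambda>n. (norm (s (X n)))\<^sup>2) \<longlonglongrightarrow> f x * (norm (s x))\<^sup>2 / f x"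
    by (rule Lim_transform_eventually)
  then have "(\<lambda>n. (norm (s (X n)))\<^sup>2) \<longlonglongrightarrow> (norm (s x))\<^sup>2"
    using f(2) by simp
  with sX show "(\<lambda>n. s (X n)) \<longlonglongrightarrow> s x"
    by (rule tendsto_of_inner_of_norm)
qed

section \<open>Equivalence of the three conditions\<close>

theorem theorem5p6:
  fixes f :: "'a::{real_inner, complete_space} \<Rightarrow> real"
    and s G :: "'a \<Rightarrow> 'a"
    and C :: "'a set"
    and xbar :: 'a
  assumes "convex_on UNIV f"
    and "continuous_on UNIV f"
    and "C = {x. f x \<le> 0}"
    and "C \<noteq> {}"
    and "subdifferential_selection f s"
    and "G = subgradient_projector f s"
    and "xbar \<in> UNIV - C"
  shows "(f differentiable (at xbar) \<longleftrightarrow> isCont G xbar) \<and>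
    (isCont G xbar \<longleftrightarrow>
      gateaux_differentiable_at f xbar \<and> strong_to_weak_continuous_at G xbar)"
proof -
  have pos: "f xbar > 0"
    using assms(3,7) by auto
  have cont: "isCont f xbar"
    using assms(2) by (simp add: continuous_on_eq_continuous_at)
  have s0: "s y \<noteq> 0" if "f y > 0" for y
  proof -
    obtain z where "f z \<le> 0"
      using assms(3,4) by auto
    then have "0 \<notin> subdifferential f y"
      using that by (rule subdifferential_nonzero)
    moreover have "s y \<in> subdifferential f y"
      using assms(5) by (simp add: subdifferential_selection_def)
    ultimately show ?thesis
      by metis
  qed
  have diff: "f differentiable (at xbar) \<longleftrightarrow> isCont s xbar"
    using assms(5) by (rule differentiable_iff_isCont_subgradient)
  have G: "isCont G xbar \<longleftrightarrow> isCont s xbar"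
    unfolding assms(6) using cont pos s0 by (intro isCont_subgradient_projector_iff) auto
  \<comment> \<open>Gateaux differentiability enters with the single direction
    \<open>h = s xbar\<close>.\<close>
  have "isCont s xbar"
    if "gateaux_differentiable_at f xbar" "strong_to_weak_continuous_at G xbar"
    using cont pos s0[OF pos]
      gateaux_differentiable_at_imp_isCont_inner_subgradient[OF that(1) assms(2,5)]
      that(2)[unfolded assms(6)]
    by (rule strong_to_weak_continuous_at_imp_isCont_subgradient)
  \<comment> \<open>Continuity of \<open>G\<close> yields Gateaux differentiability by way of
    \<open>isCont s xbar\<close> and Frechet differentiability.\<close>
  then show ?thesis
    using diff G differentiable_imp_gateaux_differentiable_at
      isCont_imp_strong_to_weak_continuous_at by blast
qed

end
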